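(* Let $H$ be a Hilbert space and let $F:H\to H$ be a bounded linear operator with closed range and finite dimensional kernel. Then for every closed linear subspace $L\subset H$ and every Hilbert space $W$, the image $(F\otimes 1)(L\otimes W)\subset H\otimes W$ is closed, where $\otimes$ denotes the Hilbert space tensor product.
   Context: $L\otimes W\subset H\otimes W$ denotes the (completed) Hilbert space tensor product, and $F\otimes 1:H\otimes W\to H\otimes W$ is the bounded operator induced by $F$. *)

theory Defs
  imports "HOL-Analysis.Analysis"
begin

text \<open>
  The real and the complex case are treated at once. The axioms below leave no other scalar
  fields: expanding \<open>norm (1 + x)^2\<close> shows that \<open>x + sconj x\<close> is real, so every \<open>x\<close> is a root of
  the real quadratic polynomial with root sum \<open>x + sconj x\<close> and root product \<open>norm x ^ 2\<close>; hence the
  field is the reals or the complex numbers, with \<open>sconj\<close> the identity or complex conjugation.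
\<close>

class real_or_complex = real_normed_field +
  fixes sconj :: "'a \<Rightarrow> 'a"
  assumes sconj_add: "sconj (x + y) = sconj x + sconj y"
    and mult_sconj: "x * sconj x = (norm x)\<^sup>2 *\<^sub>R 1"

instantiation real :: real_or_complex
begin
definition sconj_real :: "real \<Rightarrow> real" where "sconj_real x = x"
instance by standard (auto simp: sconj_real_def power2_eq_square)
end

instantiation complex :: real_or_complex
begin
definition sconj_complex :: "complex \<Rightarrow> complex" where "sconj_complex x = cnj x"
instance
  by standard (simp_all add: sconj_complex_def complex_norm_square scaleR_conv_of_real del: of_real_power)
end

text \<open>
  Norm, topology and completeness are those of the class \<^class>\<open>banach\<close>; the axioms
  \<open>scale_of_real\<close> and \<open>inner_self\<close> tie them to the scalar multiplication and the inner product.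
  The inner product is linear in its first and conjugate-linear in its second argument.
\<close>

locale hilbert_space = vector_space scale
  for scale :: "'k::real_or_complex \<Rightarrow> 'a::banach \<Rightarrow> 'a" +
  fixes ip :: "'a \<Rightarrow> 'a \<Rightarrow> 'k"
  assumes scale_of_real: "scale (of_real r) x = r *\<^sub>R x"
    and inner_add_left: "ip (x + y) z = ip x z + ip y z"
    and inner_scale_left: "ip (scale c x) y = c * ip x y"
    and inner_commute: "ip y x = sconj (ip x y)"
    and inner_self: "ip x x = of_real ((norm x)\<^sup>2)"

lemma hilbert_space_real_inner:
  "hilbert_space (scaleR :: real \<Rightarrow> 'a::{real_inner,banach} \<Rightarrow> 'a) inner"
  by unfold_locales
    (simp_all add: algebra_simps inner_commute sconj_real_def inner_add_left power2_norm_eq_inner)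

definition bounded_operator ::
    "('k::field \<Rightarrow> 'a::real_normed_vector \<Rightarrow> 'a) \<Rightarrow> ('k \<Rightarrow> 'b::real_normed_vector \<Rightarrow> 'b)
      \<Rightarrow> ('a \<Rightarrow> 'b) \<Rightarrow> bool"
  where "bounded_operator s t F \<longleftrightarrow> Vector_Spaces.linear s t F \<and> bounded_linear F"

text \<open>
  The Hilbert space \<open>T\<close> with the elementary tensors \<open>tens h w\<close> is a Hilbert space tensor product of
  \<open>H\<close> and \<open>W\<close>. By \<open>inner_tens\<close> the span of the elementary tensors is the algebraic tensor product
  with its canonical inner product, and by \<open>dense_tens\<close> the complete space \<open>T\<close> is its completion.
  This determines \<open>(T, tens)\<close> up to a unique unitary isomorphism.
\<close>

locale hilbert_tensor_product =
  H: hilbert_space scaleH ipH + W: hilbert_space scaleW ipW + T: hilbert_space scaleT ipT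
  for scaleH :: "'k::real_or_complex \<Rightarrow> 'h::banach \<Rightarrow> 'h" and ipH
    and scaleW :: "'k \<Rightarrow> 'w::banach \<Rightarrow> 'w" and ipW
    and scaleT :: "'k \<Rightarrow> 't::banach \<Rightarrow> 't" and ipT +
  fixes tens :: "'h \<Rightarrow> 'w \<Rightarrow> 't"
  assumes linear_left: "Vector_Spaces.linear scaleH scaleT (\<lambda>h. tens h w)"
    and linear_right: "Vector_Spaces.linear scaleW scaleT (\<lambda>w. tens h w)"
    and inner_tens: "ipT (tens h w) (tens h' w') = ipH h h' * ipW w w'"
    and dense_tens: "closure (T.span {tens h w |h w. True}) = UNIV"

text \<open>The closed subspace \<open>L \<otimes> W\<close> of \<open>H \<otimes> W\<close>, for a closed subspace \<open>L\<close> of \<open>H\<close>.\<close>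

definition tensor_subspace ::
    "('k::field \<Rightarrow> 't::real_normed_vector \<Rightarrow> 't) \<Rightarrow> ('h \<Rightarrow> 'w \<Rightarrow> 't) \<Rightarrow> 'h set \<Rightarrow> 't set"
  where "tensor_subspace scaleT tens L = closure (module.span scaleT {tens h w |h w. h \<in> L})"

text \<open>
  The operator \<open>F \<otimes> 1\<close>. For a bounded operator \<open>F\<close> on a tensor factor, a bounded operator with this
  action on elementary tensors exists; it is unique because these span a dense subspace.
\<close>

definition tensor_one ::
    "('k::field \<Rightarrow> 't::real_normed_vector \<Rightarrow> 't) \<Rightarrow> ('h \<Rightarrow> 'w \<Rightarrow> 't) \<Rightarrow> ('h \<Rightarrow> 'h) \<Rightarrow> 't \<Rightarrow> 't"
  where "tensor_one scaleT tens F =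
    (THE G. bounded_operator scaleT scaleT G \<and> (\<forall>h w. G (tens h w) = tens (F h) w))"

end

theory Submission
  imports Defs
begin

text \<open>
  Since \<open>ker F\<close> is finite dimensional, \<open>L + ker F\<close> is closed, and hence so is \<open>F L\<close>. Let \<open>Q = 1 - P\<close> with
  \<open>P\<close> the orthogonal projection onto \<open>L \<inter> ker F\<close>. Then \<open>F Q = F\<close> and \<open>Q L \<subseteq> L\<close>, and by the open mapping
  theorem \<open>\<parallel>Q x\<parallel> \<le> C \<parallel>F x\<parallel>\<close> on \<open>L\<close>. Writing algebraic tensors as \<open>\<Sum>e. g\<^sub>e \<otimes> e\<close> over an orthonormal
  family transfers the estimate to \<open>\<parallel>(Q \<otimes> 1) t\<parallel> \<le> C \<parallel>(F \<otimes> 1) t\<parallel>\<close> on \<open>L \<otimes> W\<close>. So if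
  \<open>(F \<otimes> 1) t\<^sub>n \<longlonglongrightarrow> y\<close>, then \<open>(Q \<otimes> 1) t\<^sub>n\<close> is a Cauchy sequence in \<open>L \<otimes> W\<close>, and \<open>F \<otimes> 1\<close> maps its
  limit to \<open>y\<close>.
\<close>

subsection \<open>The open mapping theorem\<close>

text \<open>The image of \<open>S\<close> is complete, so Baire's theorem applies inside it and
  gives preimages that are approximate but controlled in norm. Correcting the error repeatedly, with
  the error halved each time, turns them into exact ones.\<close>

lemma open_mapping_preimage_bound:
  fixes F :: "'a::banach \<Rightarrow> 'b::banach"
  assumes F: "bounded_linear F" and S: "subspace S" "closed S" and cl: "closed (F ` S)"
  obtains C where "\<And>x. x \<in> S \<Longrightarrow> \<exists>x'\<in>S. F x' = F x \<and> norm x' \<le> C * norm (F x)"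
proof -
  interpret F: bounded_linear F by fact
  define Y where "Y = F ` S"
  have Y: "subspace Y" unfolding Y_def using F.linear_axioms S(1) by (rule linear_subspace_image)
  \<comment> \<open>Baire's theorem needs closed sets, hence the closure; the iteration at the end
    removes it again.\<close>
  define D where "D n = closure (F ` (S \<inter> ball 0 n))" for n :: real
  have D_sub: "D n \<subseteq> Y" for n
    unfolding D_def Y_def by (rule closure_minimal) (use cl in auto)
  have D_diff: "a - b \<in> D (m + n)" if a: "a \<in> D m" and b: "b \<in> D n" for a b m n
  proof -
    obtain u where u: "\<And>k. u k \<in> F ` (S \<inter> ball 0 m)" "u \<longlonglongrightarrow> a"
      using a unfolding D_def closure_sequential by blast
    obtain v where v: "\<And>k. v k \<in> F ` (S \<inter> ball 0 n)" "v \<longlonglongrightarrow> b"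
      using b unfolding D_def closure_sequential by blast
    have "u k - v k \<in> F ` (S \<inter> ball 0 (m + n))" for k
    proof -
      obtain x y where "x \<in> S" "y \<in> S" "u k = F x" "v k = F y" "norm x < m" "norm y < n"
        using u(1)[of k] v(1)[of k] by auto
      moreover have "norm (x - y) < m + n"
        using norm_triangle_ineq4[of x y] calculation by linarith
      ultimately show ?thesis
        by (intro image_eqI[of _ _ "x - y"]) (auto simp: F.diff subspace_diff[OF S(1)])
    qed
    moreover have "(\<lambda>k. u k - v k) \<longlonglongrightarrow> a - b" using u v by (intro tendsto_diff)
    ultimately show ?thesis
      unfolding D_def closure_sequential by (intro exI[of _ "\<lambda>k. u k - v k"]) simp
  qed
  have "\<exists>n::nat. top_of_set Y interior_of D n \<noteq> {}"
  proof (rule ccontr)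
    assume neg: "\<not> ?thesis"
    \<comment> \<open>\<open>Y\<close> is closed in a Banach space, hence completely metrizable, so
      countably many closed sets without interior cannot cover it.\<close>
    have "top_of_set Y interior_of \<Union> (range (\<lambda>n::nat. D n)) = {}"
    proof (rule Baire_category_alt)
      show "completely_metrizable_space (top_of_set Y) \<or> locally_compact_space (top_of_set Y) \<and> regular_space (top_of_set Y)"
        using cl completely_metrizable_space_closedin completely_metrizable_space_euclidean
        unfolding Y_def by (metis closed_closedin)
    next
      fix T assume "T \<in> range (\<lambda>n::nat. D n)"
      then show "closedin (top_of_set Y) T \<and> top_of_set Y interior_of T = {}"
        using neg D_sub by (auto simp: D_def closed_subset)
    qed simp
    moreover have "\<Union> (range (\<lambda>n::nat. D n)) = Y"
    proof
      show "\<Union> (range (\<lambda>n::nat. D n)) \<subseteq> Y" using D_sub by blast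
      show "Y \<subseteq> \<Union> (range (\<lambda>n::nat. D n))"
      proof
        fix y assume "y \<in> Y"
        then obtain x where x: "x \<in> S" "y = F x" by (auto simp: Y_def)
        obtain n :: nat where "norm x < n" using reals_Archimedean2 by blast
        then have "y \<in> D n" unfolding D_def using x by (intro closure_subset[THEN subsetD]) auto
        then show "y \<in> \<Union> (range (\<lambda>n::nat. D n))" by blast
      qed
    qed
    ultimately have "Y = {}"
      by (metis interior_of_topspace topspace_euclidean_subtopology)
    then show False using Y subspace_0 by blast
  qed
  then obtain n :: nat and y0 where "y0 \<in> top_of_set Y interior_of D n" by blast
  then obtain U where U: "openin (top_of_set Y) U" "y0 \<in> U" "U \<subseteq> D n"
    by (auto simp: interior_of_def)
  then obtain r where r: "r > 0" "ball y0 r \<inter> Y \<subseteq> U"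
    by (metis openin_contains_ball)
  have "y0 \<in> Y" using U D_sub by blast
  \<comment> \<open>Subtracting the centre \<open>y0\<close> moves the ball found in
    \<open>D n\<close> to the origin; by \<open>D_diff\<close> this doubles the radius.\<close>
  define N where "N = real n + real n"
  have ball_D: "y \<in> D N" if "y \<in> Y" "norm y < r" for y
  proof -
    have "y0 + y \<in> D n"
    proof -
      have "y0 + y \<in> ball y0 r \<inter> Y"
        using that \<open>y0 \<in> Y\<close> Y by (simp add: subspace_add dist_norm)
      then show ?thesis using r(2) U(3) by blast
    qed
    then have "y0 + y - y0 \<in> D N" unfolding N_def by (rule D_diff) (use U in blast)
    then show ?thesis by simp
  qed
  \<comment> \<open>An empty ball would have an empty image with empty closure, yet
    \<open>D N\<close> contains 0.\<close>
  have N: "N > 0"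
  proof -
    have "0 \<in> D N" using ball_D[of 0] r Y by (simp add: subspace_0)
    then have "ball (0::'a) N \<noteq> {}" unfolding D_def by (metis Int_empty_right closure_empty empty_iff image_empty)
    then show ?thesis by simp
  qed
  define C where "C = 2 * N / r"
  have approx: "\<exists>x\<in>S. norm x \<le> C * norm y \<and> norm (y - F x) \<le> norm y / 2" if y: "y \<in> Y" for y
  proof (cases "y = 0")
    case True
    then show ?thesis using S by (intro bexI[of _ 0]) (auto simp: subspace_0 F.zero)
  next
    case False
    \<comment> \<open>The rescaled vector has norm \<open>r / 2\<close>, so \<open>ball_D\<close>
      applies to it; the tolerance \<open>t * norm y / 2\<close> becomes \<open>norm y / 2\<close>
      after dividing by \<open>t\<close>.\<close>
    define t where "t = r / (2 * norm y)"
    have t: "t > 0" using False r by (simp add: t_def)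
    have "norm (t *\<^sub>R y) < r" using False r by (simp add: t_def)
    then have "t *\<^sub>R y \<in> D N" using ball_D y Y by (simp add: subspace_scale)
    moreover have "t * norm y / 2 > 0" using t False by simp
    ultimately obtain q where q: "q \<in> F ` (S \<inter> ball 0 N)" "dist q (t *\<^sub>R y) < t * norm y / 2"
      unfolding D_def closure_approachable by blast
    then obtain z where z: "z \<in> S" "norm z < N" "dist (F z) (t *\<^sub>R y) < t * norm y / 2"
      by auto
    have "y - F (z /\<^sub>R t) = (t *\<^sub>R y - F z) /\<^sub>R t"
      using t by (simp add: F.scaleR scaleR_diff_right)
    then have "norm (y - F (z /\<^sub>R t)) = dist (F z) (t *\<^sub>R y) / t"
      using t by (simp add: dist_norm norm_minus_commute divide_inverse)
    also have "\<dots> \<le> norm y / 2" using z(3) t by (simp add: field_simps)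
    finally have 1: "norm (y - F (z /\<^sub>R t)) \<le> norm y / 2" .
    have "norm (z /\<^sub>R t) = norm z / t" using t by (simp add: divide_inverse)
    also have "\<dots> \<le> N / t" using z(2) t by (simp add: divide_right_mono)
    also have "\<dots> = C * norm y" using False r by (simp add: C_def t_def)
    finally show ?thesis using 1 z(1) S by (intro bexI[of _ "z /\<^sub>R t"]) (auto simp: subspace_scale)
  qed
  then obtain X where X: "\<And>y. y \<in> Y \<Longrightarrow> X y \<in> S" "\<And>y. y \<in> Y \<Longrightarrow> norm (X y) \<le> C * norm y"
    "\<And>y. y \<in> Y \<Longrightarrow> norm (y - F (X y)) \<le> norm y / 2" by metis
  have C: "C > 0" using N r by (simp add: C_def)
  show ?thesis
  \<comment> \<open>The factor 2 is the sum of the geometric series with ratio 1/2 that bounds all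
    corrections together.\<close>
  proof (rule that[of "C * 2"])
    fix x assume "x \<in> S"
    \<comment> \<open>\<open>w k\<close> is the part of \<open>F x\<close> still unmatched after
      \<open>k\<close> corrections, and \<open>X (w k)\<close> is the next correction.\<close>
    define w where "w k = ((\<lambda>y. y - F (X y)) ^^ k) (F x)" for k
    have w0: "w 0 = F x" and wS: "w (Suc k) = w k - F (X (w k))" for k by (simp_all add: w_def)
    have wY: "w k \<in> Y" for k
    proof (induction k)
      case 0 then show ?case using \<open>x \<in> S\<close> by (simp add: w0 Y_def)
    next
      case (Suc k) then show ?case using X(1)[of "w k"] Y unfolding wS
        by (intro subspace_diff) (auto simp: Y_def)
    qed
    have wn: "norm (w k) \<le> norm (F x) * (1/2) ^ k" for k
    proof (induction k)
      case (Suc k) then show ?case using X(3)[OF wY[of k]] by (simp add: wS)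
    qed (simp add: w0)
    have Xn: "norm (X (w k)) \<le> C * norm (F x) * (1/2) ^ k" for k
      using order_trans[OF X(2)[OF wY[of k]] mult_left_mono[OF wn[of k], of C]] C
      by (simp add: mult.assoc)
    have geo: "(\<lambda>k. C * norm (F x) * (1/2) ^ k) sums (C * norm (F x) * 2)"
      using sums_mult[OF geometric_sums[of "1/2::real"], of "C * norm (F x)"] by simp
    have sum: "summable (\<lambda>k. norm (X (w k)))"
      by (rule summable_comparison_test'[OF sums_summable[OF geo], of 0]) (use Xn in auto)
    then have sX: "summable (\<lambda>k. X (w k))" by (rule summable_norm_cancel)
    define x' where "x' = (\<Sum>k. X (w k))"
    have lim: "(\<lambda>n. \<Sum>k<n. X (w k)) \<longlonglongrightarrow> x'"
      using sX unfolding x'_def by (rule summable_LIMSEQ)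
    have "x' \<in> S"
      by (rule closed_sequentially[OF S(2) _ lim]) (auto intro!: subspace_sum S X wY)
    moreover have "F x' = F x"
    proof -
      have "F (\<Sum>k<n. X (w k)) = F x - w n" for n
        by (induction n) (auto simp: F.add wS w0 F.zero)
      moreover have "w \<longlonglongrightarrow> 0"
      proof (rule Lim_null_comparison)
        show "\<forall>\<^sub>F k in sequentially. norm (w k) \<le> norm (F x) * (1/2) ^ k" using wn by simp
        show "(\<lambda>k. norm (F x) * (1/2) ^ k) \<longlonglongrightarrow> 0"
          by (intro tendsto_mult_right_zero LIMSEQ_realpow_zero) auto
      qed
      ultimately have "(\<lambda>n. F (\<Sum>k<n. X (w k))) \<longlonglongrightarrow> F x" using tendsto_diff[OF tendsto_const, of w 0 _ "F x"] by simp
      then show ?thesis using F.tendsto[OF lim] LIMSEQ_unique by blast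
    qed
    moreover have "norm x' \<le> C * 2 * norm (F x)"
    proof -
      have "norm x' \<le> (\<Sum>k. norm (X (w k)))" unfolding x'_def using sum by (rule summable_norm)
      also have "\<dots> \<le> (\<Sum>k. C * norm (F x) * (1/2) ^ k)"
        using Xn sum sums_summable[OF geo] by (intro suminf_le) auto
      also have "\<dots> = C * 2 * norm (F x)" using sums_unique[OF geo] by simp
      finally show ?thesis .
    qed
    ultimately show "\<exists>x'\<in>S. F x' = F x \<and> norm x' \<le> C * 2 * norm (F x)" by blast
  qed
qed

subsection \<open>Hilbert spaces\<close>

lemma sconj_0 [simp]: "sconj 0 = 0"
  using sconj_add[of 0 0] by simp

lemma norm_sconj [simp]: "norm (sconj x) = norm x"
proof (cases "x = 0")
  case False
  have "norm x * norm (sconj x) = norm x * norm x"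
    using arg_cong[OF mult_sconj[of x], of norm] by (simp add: norm_mult power2_eq_square)
  then show ?thesis using False by simp
qed simp

text \<open>Multiplicativity is no axiom of the class. It follows from \<open>mult_sconj\<close> and
  the multiplicativity of the norm by cancelling \<open>x * y\<close>.\<close>

lemma sconj_mult: "sconj (x * y) = sconj x * sconj y"
proof (cases "x * y = 0")
  case False
  have "(x * y) * sconj (x * y) = (x * sconj x) * (y * sconj y)"
    by (simp add: mult_sconj norm_mult power_mult_distrib)
  also have "\<dots> = (x * y) * (sconj x * sconj y)" by (simp add: mult_ac)
  finally show ?thesis using False by simp
qed auto

lemma mult_sconj_of_real: "x * sconj x = of_real ((norm x)\<^sup>2)"
  by (simp add: mult_sconj of_real_def)

lemma sconj_of_real [simp]: "sconj (of_real r) = of_real r"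
proof (cases "r = 0")
  case False
  have "of_real r * sconj (of_real r :: 'a) = of_real r * of_real r"
    by (simp add: mult_sconj_of_real power2_eq_square)
  then show ?thesis using False by simp
qed simp

context hilbert_space
begin

section \<open>Inner product and norm\<close>

lemma inner_add_right: "ip x (y + z) = ip x y + ip x z"
  by (metis inner_add_left inner_commute sconj_add)

lemma inner_scale_right: "ip x (scale c y) = sconj c * ip x y"
  by (metis inner_scale_left inner_commute sconj_mult)

lemma inner_zero_left [simp]: "ip 0 y = 0" and inner_zero_right [simp]: "ip y 0 = 0"
  using inner_add_left[of 0 0 y] inner_add_right[of y 0 0] by simp_all

lemma inner_diff_left: "ip (x - y) z = ip x z - ip y z"
  by (metis add_diff_cancel_right' diff_add_cancel inner_add_left)

lemma inner_sum_left: "ip (\<Sum>i\<in>I. f i) y = (\<Sum>i\<in>I. ip (f i) y)"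
  by (induction I rule: infinite_finite_induct) (auto simp: inner_add_left)

lemma inner_sum_right: "ip y (\<Sum>i\<in>I. f i) = (\<Sum>i\<in>I. ip y (f i))"
  by (induction I rule: infinite_finite_induct) (auto simp: inner_add_right)

lemma inner_eq_0_commute: "ip x y = 0 \<Longrightarrow> ip y x = 0"
  by (metis inner_commute sconj_0)

lemma inner_self_eq_0: "ip x x = 0 \<longleftrightarrow> x = 0"
  by (simp add: inner_self)

text \<open>The class \<open>banach\<close> gives homogeneity for real factors only; for factors in
  \<open>'k\<close> it comes from the inner product.\<close>

lemma norm_scale: "norm (scale c x) = norm c * norm x"
proof -
  have "of_real ((norm (scale c x))\<^sup>2) = (of_real ((norm c)\<^sup>2) * of_real ((norm x)\<^sup>2) :: 'k)"
    by (metis inner_scale_left inner_scale_right inner_self mult.assoc mult_sconj_of_real)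
  then have "(norm (scale c x))\<^sup>2 = (norm c * norm x)\<^sup>2"
    by (metis of_real_eq_iff of_real_mult power_mult_distrib)
  then show ?thesis by simp
qed

lemma pythagoras:
  assumes "ip x y = 0"
  shows "(norm (x + y))\<^sup>2 = (norm x)\<^sup>2 + (norm y)\<^sup>2"
proof -
  have "of_real ((norm (x + y))\<^sup>2) = (of_real ((norm x)\<^sup>2 + (norm y)\<^sup>2) :: 'k)"
    using assms inner_eq_0_commute[OF assms]
    by (simp only: inner_self[symmetric] inner_add_left inner_add_right of_real_add) simp
  then show ?thesis by (simp only: of_real_eq_iff)
qed

text \<open>\<open>open_mapping_preimage_bound\<close> speaks of real subspaces; this makes it
  applicable over \<open>'k\<close>.\<close>

lemma subspace_real: "subspace S \<Longrightarrow> real_vector.subspace S"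
  unfolding subspace_def real_vector.subspace_def by (metis scale_of_real)

section \<open>Orthonormal families and orthogonal projections\<close>

definition orthonormal :: "'a set \<Rightarrow> bool"
  where "orthonormal E \<longleftrightarrow> (\<forall>e\<in>E. \<forall>f\<in>E. ip e f = (if e = f then 1 else 0))"

text \<open>For finite orthonormal \<open>E\<close> this is the orthogonal projection onto
  \<open>span E\<close>.\<close>

definition proj :: "'a set \<Rightarrow> 'a \<Rightarrow> 'a"
  where "proj E x = (\<Sum>e\<in>E. scale (ip x e) e)"

lemma inner_proj:
  assumes "finite E" "orthonormal E" "e \<in> E"
  shows "ip (proj E x) e = ip x e"
proof -
  have "ip (proj E x) e = (\<Sum>f\<in>E. ip x f * ip f e)"
    by (simp add: proj_def inner_sum_left inner_scale_left)
  also have "\<dots> = (\<Sum>f\<in>E. if f = e then ip x e else 0)"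
    by (rule sum.cong) (use assms in \<open>auto simp: orthonormal_def\<close>)
  finally show ?thesis using assms by simp
qed

lemma proj_in_span: "proj E x \<in> span E"
  unfolding proj_def by (intro span_sum span_scale span_base)

lemma inner_eq_0_span:
  assumes "y \<in> span E" "\<And>e. e \<in> E \<Longrightarrow> ip z e = 0"
  shows "ip z y = 0"
  using assms(1)
  by (rule span_induct_alt) (simp_all add: assms(2) inner_add_right inner_scale_right)

lemma inner_diff_proj:
  assumes "finite E" "orthonormal E" "y \<in> span E"
  shows "ip (x - proj E x) y = 0"
  using assms(3) by (rule inner_eq_0_span) (simp add: inner_diff_left inner_proj assms)

lemma proj_eq:
  assumes "finite E" "orthonormal E" "x \<in> span E"
  shows "proj E x = x"
  using inner_diff_proj[OF assms(1,2), of "x - proj E x" x] assms(3)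
  by (simp add: span_diff proj_in_span inner_self_eq_0)

lemma norm_proj:
  assumes "finite E" "orthonormal E"
  shows "(norm x)\<^sup>2 = (norm (x - proj E x))\<^sup>2 + (norm (proj E x))\<^sup>2"
  using pythagoras[OF inner_diff_proj[OF assms proj_in_span, of x x]] by simp

lemma norm_diff_proj_le:
  assumes "finite E" "orthonormal E"
  shows "norm (x - proj E x) \<le> norm x"
  by (rule power2_le_imp_le) (use norm_proj[OF assms, of x] in auto)

lemma proj_add: "proj E (x + y) = proj E x + proj E y"
  by (simp add: proj_def inner_add_left scale_left_distrib sum.distrib)

lemma proj_scale: "proj E (scale c x) = scale c (proj E x)"
  by (simp add: proj_def inner_scale_left scale_sum_right)

lemma bounded_operatorI:
  assumes "\<And>x y. G (x + y) = G x + G y" "\<And>c x. G (scale c x) = scale c (G x)"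
    and "\<And>x. norm (G x) \<le> C * norm x"
  shows "bounded_operator scale scale G"
proof -
  have "bounded_linear G"
    by (rule bounded_linear_intro[of _ C])
      (use assms in \<open>auto simp: mult.commute scale_of_real[symmetric]\<close>)
  then show ?thesis
    unfolding bounded_operator_def Vector_Spaces.linear_iff using vector_space_axioms assms by blast
qed

lemma bounded_operator_diff_proj:
  assumes "finite E" "orthonormal E"
  shows "bounded_operator scale scale (\<lambda>x. x - proj E x)"
  by (rule bounded_operatorI[where C = 1])
    (use norm_diff_proj_le[OF assms] in \<open>auto simp: proj_add proj_scale scale_right_diff_distrib\<close>)

lemma inner_normalized:
  assumes "v \<noteq> 0"
  shows "ip (scale (of_real (inverse (norm v))) v) (scale (of_real (inverse (norm v))) v) = 1"
proof -
  have "norm (scale (of_real (inverse (norm v))) v) = 1"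
    using assms by (simp add: norm_scale norm_inverse)
  then show ?thesis by (simp only: inner_self) simp
qed

text \<open>Induction on \<open>B\<close>: the residue of the new vector after projection is either
  zero, so that the old family still suffices, or is normalized and added.\<close>

lemma gram_schmidt:
  assumes "finite B"
  obtains E where "finite E" "orthonormal E" "span E = span B"
proof -
  have "\<exists>E. finite E \<and> orthonormal E \<and> span E = span B"
    using assms
  proof (induction B)
    case empty
    show ?case by (intro exI[of _ "{}"]) (auto simp: orthonormal_def)
  next
    case (insert b B)
    then obtain E where E: "finite E" "orthonormal E" "span E = span B" by blast
    define v where "v = b - proj E b"
    have sp: "span (insert b B) = span (insert b E)"
      using E(3) by (simp add: span_insert)
    show ?case
    proof (cases "v = 0")
      case True
      then have "b \<in> span E" using proj_in_span[of E b] by (simp add: v_def)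
      then show ?thesis using E sp by (metis span_redundant)
    next
      case False
      define e where "e = scale (of_real (inverse (norm v))) v"
      have vE: "ip v f = 0" if "f \<in> E" for f
        unfolding v_def by (rule inner_diff_proj[OF E(1,2)]) (simp add: span_base that)
      have eE: "ip e f = 0" "ip f e = 0" if "f \<in> E" for f
        using vE[OF that] inner_eq_0_commute[OF vE[OF that]]
        by (simp_all add: e_def inner_scale_left inner_scale_right)
      have ee: "ip e e = 1"
        unfolding e_def using False by (rule inner_normalized)
      have "orthonormal (insert e E)"
        using E(2) eE ee unfolding orthonormal_def by auto
      moreover have "span (insert e E) = span (insert b E)"
      proof -
        have "v \<in> span (insert b E)"
          unfolding v_def using span_mono[of E "insert b E"] proj_in_span[of E b]
          by (intro span_diff) (auto intro: span_base)
        then have "e \<in> span (insert b E)" unfolding e_def by (rule span_scale)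
        moreover have "b \<in> span (insert e E)"
        proof -
          have "b = scale (of_real (norm v)) e + proj E b"
            using False by (simp add: e_def v_def flip: of_real_mult)
          also have "\<dots> \<in> span (insert e E)"
            using span_mono[of E "insert e E"] proj_in_span[of E b]
            by (intro span_add span_scale) (auto intro: span_base)
          finally show ?thesis .
        qed
        ultimately show ?thesis
          unfolding span_eq using span_superset[of "insert e E"] span_superset[of "insert b E"] by blast
      qed
      ultimately show ?thesis using E(1) sp by (metis finite_insert)
    qed
  qed
  then show ?thesis using that by blast
qed

text \<open>A maximal independent subset of \<open>M\<close> is finite because it lies in a finitely
  generated space; it is then orthonormalized.\<close>

lemma gram_schmidt_subspace:
  assumes "subspace M" "finite B" "M \<subseteq> span B"
  obtains E where "finite E" "orthonormal E" "span E = M"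
proof -
  obtain A where A: "A \<subseteq> M" "independent A" "M \<subseteq> span A"
    by (rule maximal_independent_subset)
  have "finite A" using independent_span_bound[OF assms(2) A(2)] A(1) assms(3) by blast
  moreover have "span A = M" using A assms(1) by (simp add: span_subspace)
  ultimately show ?thesis using gram_schmidt that by metis
qed

text \<open>Cauchy-Schwarz: projecting onto the line through \<open>y\<close> does not increase the
  norm.\<close>

lemma norm_inner_le: "norm (ip x y) \<le> norm x * norm y"
proof (cases "y = 0")
  case False
  define e where "e = scale (of_real (inverse (norm y))) y"
  have "ip e e = 1" unfolding e_def using False by (rule inner_normalized)
  then have on: "finite {e}" "orthonormal {e}"
    by (simp_all add: orthonormal_def)
  have ne: "norm e = 1" using False by (simp add: e_def norm_scale norm_inverse)
  have "norm (proj {e} x) \<le> norm x"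
    by (rule power2_le_imp_le) (use norm_proj[OF on, of x] in auto)
  then have "norm (ip x e) \<le> norm x" by (simp add: proj_def norm_scale ne)
  then have "norm (ip x y) / norm y \<le> norm x"
    by (simp add: e_def inner_scale_right norm_mult norm_inverse divide_inverse mult.commute)
  then show ?thesis using False by (simp add: field_simps)
qed simp

lemma bounded_linear_inner_left: "bounded_linear (\<lambda>x. ip x y)"
proof (rule bounded_linear_intro[of _ "norm y"])
  show "ip (r *\<^sub>R x) y = r *\<^sub>R ip x y" for r x
    by (simp add: inner_scale_left scaleR_conv_of_real flip: scale_of_real)
qed (simp_all add: inner_add_left norm_inner_le)

section \<open>Finite-dimensional enlargements of closed subspaces\<close>

lemma tendsto_scale_left:
  assumes "(f \<longlongrightarrow> c) A"
  shows "((\<lambda>n. scale (f n) x) \<longlongrightarrow> scale c x) A"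
proof -
  have "((\<lambda>n. norm (f n - c) * norm x) \<longlongrightarrow> 0) A"
    using assms by (intro tendsto_mult_left_zero) (simp add: LIM_zero_iff tendsto_norm_zero)
  moreover have "norm (f n - c) * norm x = norm (scale (f n) x - scale c x)" for n
    by (simp add: norm_scale flip: scale_left_diff_distrib)
  ultimately show ?thesis by (simp add: tendsto_norm_zero_iff LIM_zero_iff)
qed

text \<open>A vector \<open>v\<close> outside the closed \<open>span A\<close> has a positive
  distance \<open>d\<close> from it, so the coefficient of \<open>v\<close> in
  \<open>s + scale c v\<close> is at most \<open>norm (s + scale c v) / d\<close>. Hence in a
  convergent sequence the \<open>v\<close>-components converge, and so do the remainders in
  \<open>span A\<close>.\<close>

lemma closed_span_insert:
  assumes cl: "closed (span A)"
  shows "closed (span (insert v A))"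
proof (cases "v \<in> span A")
  case True then show ?thesis using cl by (simp add: span_redundant)
next
  case False
  then obtain d where d: "d > 0" "ball v d \<inter> span A = {}"
    using cl by (metis Compl_iff disjoint_eq_subset_Compl open_Compl open_contains_ball)
  have v0: "v \<noteq> 0" using False span_zero by auto
  have bound: "norm c * d \<le> norm (s + scale c v)" if "s \<in> span A" for c s
  proof (cases "c = 0")
    case False
    have "scale (- inverse c) s \<in> span A" using that by (rule span_scale)
    then have "d \<le> dist v (scale (- inverse c) s)" using d by (meson disjoint_iff linorder_not_le mem_ball)
    also have "dist v (scale (- inverse c) s) = norm (scale (inverse c) (s + scale c v))"
      using False by (simp add: dist_norm scale_right_distrib add.commute)
    also have "\<dots> = norm (s + scale c v) / norm c"
      by (simp add: norm_scale norm_inverse divide_inverse mult.commute)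
    finally show ?thesis using False by (simp add: field_simps)
  qed simp
  show ?thesis
    unfolding closed_sequential_limits
  proof (intro allI impI, elim conjE)
    fix x y assume x: "\<forall>n. x n \<in> span (insert v A)" and lim: "x \<longlonglongrightarrow> y"
    then have "\<forall>n. \<exists>k. x n - scale k v \<in> span A"
      by (simp add: span_insert)
    then obtain c where c: "\<And>n. x n - scale (c n) v \<in> span A"
      by metis
    have diff: "norm (c m - c n) * d \<le> norm (x m - x n)" for m n
      using bound[OF span_diff[OF c[of m] c[of n]], of "c m - c n"]
      by (simp add: scale_left_diff_distrib)
    \<comment> \<open>The class of \<open>'k\<close> does not include completeness, so the limit is
      taken in \<open>'a\<close>; pairing with \<open>v\<close> then recovers the limit of the
      coefficients.\<close>
    have "Cauchy (\<lambda>n. scale (c n) v)"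
    proof (rule metric_CauchyI)
      fix e :: real assume "e > 0"
      then have "e * d / norm v > 0" using d v0 by simp
      then obtain M where M: "\<And>m n. m \<ge> M \<Longrightarrow> n \<ge> M \<Longrightarrow> dist (x m) (x n) < e * d / norm v"
        using LIMSEQ_imp_Cauchy[OF lim] unfolding Cauchy_def by blast
      have "dist (scale (c m) v) (scale (c n) v) < e" if "m \<ge> M" "n \<ge> M" for m n
      proof -
        have "norm (c m - c n) * d < e * d / norm v"
          using diff[of m n] M[OF that] by (simp add: dist_norm)
        then have "norm (c m - c n) * norm v < e" using d v0 by (simp add: field_simps)
        then show ?thesis by (simp add: dist_norm norm_scale flip: scale_left_diff_distrib)
      qed
      then show "\<exists>M. \<forall>m\<ge>M. \<forall>n\<ge>M. dist (scale (c m) v) (scale (c n) v) < e" by blast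
    qed
    then obtain z where z: "(\<lambda>n. scale (c n) v) \<longlonglongrightarrow> z"
      using Cauchy_convergent convergent_def by blast
    have "(\<lambda>n. ip (scale (c n) v) v / ip v v) \<longlonglongrightarrow> ip z v / ip v v"
      using z v0 by (intro tendsto_divide bounded_linear.tendsto[OF bounded_linear_inner_left])
        (auto simp: inner_self_eq_0)
    then have "c \<longlonglongrightarrow> ip z v / ip v v"
      using v0 by (simp add: inner_scale_left inner_self_eq_0)
    then have "(\<lambda>n. x n - scale (c n) v) \<longlonglongrightarrow> y - scale (ip z v / ip v v) v"
      by (intro tendsto_diff lim tendsto_scale_left)
    then have "y - scale (ip z v / ip v v) v \<in> span A"
      by (rule closed_sequentially[OF cl c])
    then show "y \<in> span (insert v A)" unfolding span_insert by blast
  qed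
qed

lemma closed_span_Un:
  assumes "finite B" "closed (span A)"
  shows "closed (span (B \<union> A))"
  using assms(1) by induction (simp_all add: assms(2) closed_span_insert)

section \<open>Operators with closed range and finite-dimensional kernel\<close>

lemma bounded_operatorD:
  assumes "bounded_operator scale scale G"
  shows "bounded_linear G" "G (x + y) = G x + G y" "G (scale c x) = scale c (G x)"
    "G (x - y) = G x - G y" "G 0 = 0"
  using assms unfolding bounded_operator_def Vector_Spaces.linear_iff
  by (auto simp: linear_diff linear_0 dest: bounded_linear.linear)

lemma bounded_linear_scale: "bounded_linear (scale c)"
  by (rule bounded_linear_intro[of _ "norm c"])
    (simp_all add: scale_right_distrib norm_scale mult.commute flip: scale_of_real)

text \<open>A limit of points \<open>F (x n)\<close> with \<open>x n\<close> in \<open>L\<close> has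
  a preimage \<open>u\<close>, as the range is closed. The open mapping bound corrects
  \<open>u\<close> by vectors tending to 0 so that it lies in \<open>L + ker F\<close>. That sum is
  closed, so it contains \<open>u\<close>, and \<open>F\<close> kills the kernel part.\<close>

lemma closed_image_subspace:
  assumes F: "bounded_operator scale scale F" and cl: "closed (range F)"
    and B: "finite B" "{x. F x = 0} = span B" and L: "subspace L" "closed L"
  shows "closed (F ` L)"
proof -
  note F = bounded_operatorD[OF F]
  obtain C where C: "\<And>x. \<exists>x'. F x' = F x \<and> norm x' \<le> C * norm (F x)"
    using open_mapping_preimage_bound[OF F(1) subspace_real[OF subspace_UNIV] closed_UNIV cl] by auto
  have sL: "span L = L" using L(1) by (simp only: span_eq_iff)
  define K where "K = span (B \<union> L)"
  have K: "closed K" unfolding K_def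
    by (rule closed_span_Un[OF B(1)]) (simp only: sL L(2))
  show ?thesis
    unfolding closed_sequential_limits
  proof (intro allI impI, elim conjE)
    fix y z assume y: "\<forall>n. y n \<in> F ` L" and lim: "y \<longlonglongrightarrow> z"
    then have "\<forall>n. \<exists>x\<in>L. y n = F x" by (simp add: image_iff)
    then obtain x where x: "\<And>n. x n \<in> L" "\<And>n. F (x n) = y n" by metis
    have "z \<in> range F"
      by (rule closed_sequentially[OF cl _ lim]) (simp flip: x(2))
    then obtain u where u: "F u = z" by blast
    \<comment> \<open>\<open>x n - u\<close> need not be small, but its image \<open>y n - z\<close>
      tends to 0, so a preimage \<open>v n\<close> of controlled norm does too.\<close>
    have "\<forall>n. \<exists>v. F v = F (x n - u) \<and> norm v \<le> C * norm (F (x n - u))" using C by blast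
    then obtain v where v: "\<And>n. F (v n) = F (x n - u)" "\<And>n. norm (v n) \<le> C * norm (F (x n - u))"
      by metis
    have "v \<longlonglongrightarrow> 0"
    proof (rule Lim_null_comparison)
      show "\<forall>\<^sub>F n in sequentially. norm (v n) \<le> C * norm (y n - z)"
        using v(2) x(2) u F(4) by simp
      show "(\<lambda>n. C * norm (y n - z)) \<longlonglongrightarrow> 0"
        using lim by (intro tendsto_mult_right_zero tendsto_norm_zero) (simp add: LIM_zero_iff)
    qed
    then have lim_uv: "(\<lambda>n. u + v n) \<longlonglongrightarrow> u + 0" by (intro tendsto_add tendsto_const)
    have uvK: "u + v n \<in> K" for n
    proof -
      \<comment> \<open>This difference lies in the kernel, by the choice of
        \<open>v n\<close>.\<close>
      have "u + v n - x n \<in> span B"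
        using v(1)[of n] unfolding B(2)[symmetric] by (simp add: F)
      then have "u + v n - x n \<in> K" unfolding K_def by (meson UnCI span_mono subsetD subsetI)
      moreover have "x n \<in> K" unfolding K_def using x(1) by (simp add: span_base)
      ultimately have "u + v n - x n + x n \<in> K" unfolding K_def by (rule span_add)
      then show ?thesis by simp
    qed
    have "u + 0 \<in> K" by (rule closed_sequentially[OF K uvK lim_uv])
    then obtain k l where kl: "u = k + l" "k \<in> span B" "l \<in> span L"
      unfolding K_def span_Un by auto
    have "F k = 0" using kl(2) B(2) by blast
    then have "F u = F l" using kl(1) by (simp add: F)
    moreover have "l \<in> L" using kl(3) by (simp only: sL)
    ultimately show "z \<in> F ` L" using u by blast
  qed
qed

text \<open>\<open>Q\<close> removes the component in \<open>L \<inter> ker F\<close>. On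
  \<open>L\<close> it therefore depends only on \<open>F x\<close>, so \<open>x\<close> may be
  replaced by the preimage of controlled norm.\<close>

lemma ex_operator_bounded_by:
  assumes F: "bounded_operator scale scale F" and cl: "closed (range F)"
    and B: "finite B" "{x. F x = 0} = span B" and L: "subspace L" "closed L"
  obtains Q C where "bounded_operator scale scale Q" "C \<ge> 0"
    "\<And>x. x \<in> L \<Longrightarrow> Q x \<in> L" "\<And>x. F (Q x) = F x" "\<And>x. x \<in> L \<Longrightarrow> norm (Q x) \<le> C * norm (F x)"
proof -
  note F' = bounded_operatorD[OF F]
  obtain C where C: "\<And>x. x \<in> L \<Longrightarrow> \<exists>x'\<in>L. F x' = F x \<and> norm x' \<le> C * norm (F x)"
    using open_mapping_preimage_bound[OF F'(1) subspace_real[OF L(1)] L(2) closed_image_subspace[OF assms]]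
    by blast
  define M where "M = L \<inter> span B"
  have "subspace M" unfolding M_def by (intro subspace_inter L subspace_span)
  then obtain E where E: "finite E" "orthonormal E" "span E = M"
    using gram_schmidt_subspace[OF _ B(1)] unfolding M_def by (metis Int_lower2)
  define Q where "Q x = x - proj E x" for x
  have pM: "proj E x \<in> M" for x using proj_in_span E(3) by blast
  show ?thesis
  \<comment> \<open>The open mapping constant comes without a sign; comparing squares of norms later
    requires it to be nonnegative.\<close>
  proof (rule that[of Q "max C 0"])
    show "bounded_operator scale scale Q"
      unfolding Q_def using E(1,2) by (rule bounded_operator_diff_proj)
    show "Q x \<in> L" if "x \<in> L" for x
      unfolding Q_def using that pM L(1) by (auto simp: M_def intro: subspace_diff)
    show "F (Q x) = F x" for x
      using pM[of x] unfolding M_def B(2)[symmetric] by (simp add: Q_def F')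
    show "norm (Q x) \<le> max C 0 * norm (F x)" if x: "x \<in> L" for x
    proof -
      obtain x' where x': "x' \<in> L" "F x' = F x" "norm x' \<le> C * norm (F x)" using C[OF x] by blast
      have "x - x' \<in> L" using x x'(1) L(1) by (intro subspace_diff)
      moreover have "x - x' \<in> span B" unfolding B(2)[symmetric] using x'(2) by (simp add: F')
      \<comment> \<open>The difference of two preimages in \<open>L\<close> lies in
        \<open>M\<close>, so \<open>Q\<close> annihilates it.\<close>
      ultimately have "proj E (x - x') = x - x'"
        using E by (intro proj_eq) (auto simp: M_def)
      then have "Q x = Q x'"
        using proj_add[of E "x - x'" x'] by (simp add: Q_def)
      then have "norm (Q x) \<le> norm x'"
        unfolding Q_def using norm_diff_proj_le[OF E(1,2)] by simp
      also have "\<dots> \<le> max C 0 * norm (F x)"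
        using x'(3) mult_right_mono[of C "max C 0" "norm (F x)"] by simp
      finally show ?thesis .
    qed
  qed simp
qed

section \<open>Extension of densely defined operators\<close>

text \<open>Starting from a relation makes well-definedness a consequence of \<open>bound\<close>,
  which suits tensors with many representations. The bound survives in the closure \<open>S\<close>
  of \<open>R\<close>; it makes \<open>S\<close> single-valued and, by completeness and density,
  total.\<close>

lemma bounded_operator_of_graph:
  assumes add: "\<And>a b c d. (a, b) \<in> R \<Longrightarrow> (c, d) \<in> R \<Longrightarrow> (a + c, b + d) \<in> R"
    and scl: "\<And>a b k. (a, b) \<in> R \<Longrightarrow> (scale k a, scale k b) \<in> R"
    and bound: "\<And>a b. (a, b) \<in> R \<Longrightarrow> norm b \<le> C * norm a"
    and dense: "closure (fst ` R) = UNIV"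
  obtains G where "bounded_operator scale scale G" "\<And>a b. (a, b) \<in> R \<Longrightarrow> G a = b"
proof -
  define S where "S = closure R"
  have bS: "norm b \<le> C * norm a" if "(a, b) \<in> S" for a b
  proof -
    have "S \<subseteq> {p. norm (snd p) \<le> C * norm (fst p)}"
      unfolding S_def using bound
      by (intro closure_minimal closed_Collect_le continuous_intros) auto
    then show ?thesis using that by auto
  qed
  have aS: "(a + c, b + d) \<in> S" if ab: "(a, b) \<in> S" and cd: "(c, d) \<in> S" for a b c d
  proof -
    obtain x where x: "\<And>n. x n \<in> R" "x \<longlonglongrightarrow> (a, b)"
      using ab unfolding S_def closure_sequential by blast
    obtain y where y: "\<And>n. y n \<in> R" "y \<longlonglongrightarrow> (c, d)"
      using cd unfolding S_def closure_sequential by blast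
    have "x n + y n \<in> R" for n
      using add[of "fst (x n)" "snd (x n)" "fst (y n)" "snd (y n)"] x(1)[of n] y(1)[of n]
      by (simp add: plus_prod_def)
    moreover have "(\<lambda>n. x n + y n) \<longlonglongrightarrow> (a + c, b + d)"
      using tendsto_add[OF x(2) y(2)] by simp
    ultimately show ?thesis
      unfolding S_def closure_sequential by (intro exI[of _ "\<lambda>n. x n + y n"] conjI allI)
  qed
  have sS: "(scale k a, scale k b) \<in> S" if "(a, b) \<in> S" for k a b
  proof -
    let ?f = "\<lambda>p. (scale k (fst p), scale k (snd p))"
    have "?f ` S \<subseteq> S"
      unfolding S_def
    proof (rule image_closure_subset)
      show "continuous_on (closure R) ?f"
        by (intro continuous_on_Pair bounded_linear.continuous_on[OF bounded_linear_scale]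
            continuous_on_fst continuous_on_snd continuous_on_id)
      show "?f ` R \<subseteq> closure R" using scl closure_subset by fastforce
    qed simp
    then show ?thesis using that by force
  qed
  have dS: "(a - c, b - d) \<in> S" if "(a, b) \<in> S" "(c, d) \<in> S" for a b c d
    using aS[OF that(1) sS[OF that(2), of "- 1"]] by simp
  \<comment> \<open>Subtracting gives a pair \<open>(0, b - d)\<close> in \<open>S\<close>, and the
    bound forces \<open>b - d\<close> to vanish.\<close>
  have uniq: "b = d" if "(a, b) \<in> S" "(a, d) \<in> S" for a b d
    using bS[OF dS[OF that]] by simp
  have total: "\<exists>b. (a, b) \<in> S" for a
  proof -
    have "a \<in> closure (fst ` R)" using dense by simp
    then obtain x where x: "\<And>n. x n \<in> fst ` R" "x \<longlonglongrightarrow> a"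
      unfolding closure_sequential by blast
    then have "\<forall>n. \<exists>y. (x n, y) \<in> R" by force
    then obtain y where y: "\<And>n. (x n, y n) \<in> R" by metis
    then have S: "(x n, y n) \<in> S" for n unfolding S_def using closure_subset by blast
    \<comment> \<open>\<open>max C 1\<close> is positive, so the Cauchy argument may divide by
      it.\<close>
    have C: "norm (y m - y n) \<le> max C 1 * norm (x m - x n)" for m n
      using bS[OF dS[OF S[of m] S[of n]]] mult_right_mono[of C "max C 1" "norm (x m - x n)"]
      by simp
    have "Cauchy y"
    proof (rule metric_CauchyI)
      fix e :: real assume "e > 0"
      then have "e / max C 1 > 0" by simp
      then obtain M where M: "\<And>m n. m \<ge> M \<Longrightarrow> n \<ge> M \<Longrightarrow> dist (x m) (x n) < e / max C 1"
        using LIMSEQ_imp_Cauchy[OF x(2)] unfolding Cauchy_def by blast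
      have "dist (y m) (y n) < e" if "m \<ge> M" "n \<ge> M" for m n
      proof -
        have "max C 1 * norm (x m - x n) < e"
          using M[OF that] by (simp add: dist_norm pos_less_divide_eq mult.commute)
        then show ?thesis using C[of m n] by (simp add: dist_norm)
      qed
      then show "\<exists>M. \<forall>m\<ge>M. \<forall>n\<ge>M. dist (y m) (y n) < e" by blast
    qed
    then obtain b where b: "y \<longlonglongrightarrow> b" using Cauchy_convergent convergent_def by blast
    have "(a, b) \<in> S"
      by (rule closed_sequentially[of S "\<lambda>n. (x n, y n)"])
        (use S x(2) b in \<open>auto simp: S_def intro: tendsto_Pair\<close>)
    then show ?thesis by blast
  qed
  define G where "G a = (THE b. (a, b) \<in> S)" for a
  have GS: "(a, G a) \<in> S" for a
    unfolding G_def using total uniq by (metis (no_types, lifting) the_equality)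
  have G: "G a = b" if "(a, b) \<in> S" for a b using uniq[OF GS that] .
  show ?thesis
  proof (rule that[of G])
    show "bounded_operator scale scale G"
      by (rule bounded_operatorI[where C = C]) (use G aS sS bS GS in auto)
    show "G a = b" if "(a, b) \<in> R" for a b
      using that G closure_subset unfolding S_def by blast
  qed
qed

end

subsection \<open>Tensor products\<close>

context hilbert_tensor_product
begin

lemma tens_add_left: "tens (h + h') w = tens h w + tens h' w"
  and tens_scale_left: "tens (scaleH c h) w = scaleT c (tens h w)"
  and tens_add_right: "tens h (w + w') = tens h w + tens h w'"
  and tens_scale_right: "tens h (scaleW c w) = scaleT c (tens h w)"
  using linear_left linear_right unfolding Vector_Spaces.linear_iff by blast+

lemma tens_zero_left [simp]: "tens 0 w = 0" and tens_zero_right [simp]: "tens h 0 = 0"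
  using tens_add_left[of 0 0 w] tens_add_right[of h 0 0] by simp_all

lemma tens_sum_right: "tens h (\<Sum>i\<in>I. f i) = (\<Sum>i\<in>I. tens h (f i))"
  by (induction I rule: infinite_finite_induct) (auto simp: tens_add_right)

section \<open>Norm estimates on algebraic tensors\<close>

text \<open>A list is a formal representation of an algebraic tensor, and the value is what
  \<open>A \<otimes> 1\<close> should give on it. Working with representations makes this available
  before \<open>A \<otimes> 1\<close> is known to exist.\<close>

definition tens_sum :: "('h \<Rightarrow> 'h) \<Rightarrow> ('h \<times> 'w) list \<Rightarrow> 't"
  where "tens_sum A xs = (\<Sum>p\<leftarrow>xs. tens (A (fst p)) (snd p))"

lemma tens_sum_append: "tens_sum A (xs @ ys) = tens_sum A xs + tens_sum A ys"
  by (simp add: tens_sum_def)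

lemma tens_sum_scale:
  assumes "Vector_Spaces.linear scaleH scaleH A"
  shows "tens_sum A (map (\<lambda>p. (scaleH c (fst p), snd p)) xs) = scaleT c (tens_sum A xs)"
  using assms
  by (induction xs)
    (auto simp: tens_sum_def Vector_Spaces.linear_iff tens_scale_left T.scale_right_distrib)

text \<open>The cross terms vanish by orthogonality in the second factor alone; the vectors
  \<open>a e\<close> are arbitrary.\<close>

lemma norm_sum_tens_orthonormal:
  assumes "finite E" "W.orthonormal E"
  shows "(norm (\<Sum>e\<in>E. tens (a e) e))\<^sup>2 = (\<Sum>e\<in>E. (norm (a e))\<^sup>2)"
proof -
  have "of_real ((norm (\<Sum>e\<in>E. tens (a e) e))\<^sup>2) =
      (\<Sum>f\<in>E. \<Sum>e\<in>E. ipH (a e) (a f) * ipW e f)"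
    by (simp only: T.inner_self[symmetric] T.inner_sum_left T.inner_sum_right inner_tens)
  also have "\<dots> = (\<Sum>f\<in>E. \<Sum>e\<in>E. if e = f then of_real ((norm (a f))\<^sup>2) else 0)"
    using assms(2) by (intro sum.cong) (auto simp: W.orthonormal_def H.inner_self)
  also have "\<dots> = of_real (\<Sum>e\<in>E. (norm (a e))\<^sup>2)"
    using assms(1) by simp
  finally show ?thesis by (simp only: of_real_eq_iff)
qed

text \<open>The second factors are expanded in an orthonormal basis of their span and the
  coefficients are moved to the first factors. \<open>E\<close> and \<open>g\<close> do not depend
  on \<open>A\<close>, so different operators can be compared term by term.\<close>

lemma tens_sum_orthonormal:
  assumes "H.subspace L" "set xs \<subseteq> L \<times> UNIV"
  obtains E g where "finite E" "W.orthonormal E" "\<And>e. g e \<in> L"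
    "\<And>A. Vector_Spaces.linear scaleH scaleH A \<Longrightarrow> tens_sum A xs = (\<Sum>e\<in>E. tens (A (g e)) e)"
proof -
  obtain E where E: "finite E" "W.orthonormal E" "W.span E = W.span (snd ` set xs)"
    using W.gram_schmidt[of "snd ` set xs"] by auto
  \<comment> \<open>\<open>ys\<close> varies for the induction, whereas \<open>E\<close> stays fixed
    by the full list \<open>xs\<close>.\<close>
  define g where "g ys e = (\<Sum>p\<leftarrow>ys. scaleH (ipW (snd p) e) (fst p))" for ys e
  have gL: "g ys e \<in> L" if "set ys \<subseteq> L \<times> UNIV" for ys e
    using that
    by (induction ys)
      (auto simp: g_def H.subspace_0[OF assms(1)] intro!: H.subspace_add[OF assms(1)] H.subspace_scale[OF assms(1)])
  have eq: "tens_sum A ys = (\<Sum>e\<in>E. tens (A (g ys e)) e)"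
    if A: "Vector_Spaces.linear scaleH scaleH A" and "set ys \<subseteq> set xs" for A ys
    using that(2)
  proof (induction ys)
    case Nil
    have "A 0 = 0" using A by (metis H.scale_zero_left Vector_Spaces.linear_iff)
    then show ?case by (simp add: tens_sum_def g_def)
  next
    case (Cons p ys)
    obtain h w where p: "p = (h, w)" by force
    have "w \<in> W.span E"
      unfolding E(3) using Cons.prems p by (force intro: W.span_base)
    then have "tens (A h) w = tens (A h) (\<Sum>e\<in>E. scaleW (ipW w e) e)"
      using W.proj_eq[OF E(1,2)] unfolding W.proj_def by simp
    also have "\<dots> = (\<Sum>e\<in>E. tens (A (scaleH (ipW w e) h)) e)"
      using A by (simp add: tens_sum_right tens_scale_left tens_scale_right Vector_Spaces.linear_iff)
    finally have "tens_sum A (p # ys) =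
        (\<Sum>e\<in>E. tens (A (scaleH (ipW w e) h)) e) + (\<Sum>e\<in>E. tens (A (g ys e)) e)"
      using Cons by (simp add: tens_sum_def p)
    also have "\<dots> = (\<Sum>e\<in>E. tens (A (g (p # ys) e)) e)"
      using A by (simp add: g_def p tens_add_left Vector_Spaces.linear_iff flip: sum.distrib)
    finally show ?case .
  qed
  show ?thesis
    using that[OF E(1,2), of "g xs"] gL assms(2) eq by blast
qed

text \<open>In the common orthonormal expansion both squared norms are sums of squares, so the
  pointwise estimate on \<open>L\<close> transfers with the same constant.\<close>

lemma norm_tens_sum_le:
  assumes L: "H.subspace L" "set xs \<subseteq> L \<times> UNIV"
    and A: "Vector_Spaces.linear scaleH scaleH A" and B: "Vector_Spaces.linear scaleH scaleH B"
    and C: "C \<ge> 0" "\<And>x. x \<in> L \<Longrightarrow> norm (A x) \<le> C * norm (B x)"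
  shows "norm (tens_sum A xs) \<le> C * norm (tens_sum B xs)"
proof -
  obtain E g where E: "finite E" "W.orthonormal E" "\<And>e. g e \<in> L"
    "\<And>A. Vector_Spaces.linear scaleH scaleH A \<Longrightarrow> tens_sum A xs = (\<Sum>e\<in>E. tens (A (g e)) e)"
    using tens_sum_orthonormal[OF L] by blast
  have "(norm (tens_sum A xs))\<^sup>2 = (\<Sum>e\<in>E. (norm (A (g e)))\<^sup>2)"
    by (simp add: E(4) A norm_sum_tens_orthonormal E(1,2))
  also have "\<dots> \<le> (\<Sum>e\<in>E. C\<^sup>2 * (norm (B (g e)))\<^sup>2)"
    by (intro sum_mono) (metis C(2) E(3) norm_ge_zero power_mono power_mult_distrib)
  also have "\<dots> = (C * norm (tens_sum B xs))\<^sup>2"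
    by (simp add: E(4) B norm_sum_tens_orthonormal E(1,2) power_mult_distrib sum_distrib_left)
  finally show ?thesis
    by (rule power2_le_imp_le) (use C in simp)
qed

lemma linear_id: "Vector_Spaces.linear scaleH scaleH (\<lambda>x. x)"
  by (simp add: Vector_Spaces.linear_iff H.vector_space_axioms)

text \<open>Scalar coefficients are absorbed into the first factors, which stay in the subspace
  \<open>L\<close>; hence lists without coefficients suffice.\<close>

lemma span_tens_eq:
  assumes L: "H.subspace L"
  shows "T.span {tens h w |h w. h \<in> L} = tens_sum (\<lambda>x. x) ` {xs. set xs \<subseteq> L \<times> UNIV}"
proof
  show "T.span {tens h w |h w. h \<in> L} \<subseteq> tens_sum (\<lambda>x. x) ` {xs. set xs \<subseteq> L \<times> UNIV}"
  proof
    fix t assume "t \<in> T.span {tens h w |h w. h \<in> L}"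
    then show "t \<in> tens_sum (\<lambda>x. x) ` {xs. set xs \<subseteq> L \<times> UNIV}"
    proof (induction rule: T.span_induct_alt)
      case base
      show ?case by (rule image_eqI[of _ _ "[]"]) (auto simp: tens_sum_def)
    next
      case (step c x y)
      then obtain h w xs where "x = tens h w" "h \<in> L" "y = tens_sum (\<lambda>x. x) xs" "set xs \<subseteq> L \<times> UNIV"
        by blast
      then show ?case
        by (intro image_eqI[of _ _ "(scaleH c h, w) # xs"])
          (auto simp: tens_sum_def tens_scale_left H.subspace_scale[OF L])
    qed
  qed
  show "tens_sum (\<lambda>x. x) ` {xs. set xs \<subseteq> L \<times> UNIV} \<subseteq> T.span {tens h w |h w. h \<in> L}"
  proof clarify
    fix xs :: "('h \<times> 'w) list" assume xs: "set xs \<subseteq> L \<times> UNIV"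
    show "tens_sum (\<lambda>x. x) xs \<in> T.span {tens h w |h w. h \<in> L}"
      unfolding tens_sum_def
      using xs
    proof (induction xs)
      case Nil
      show ?case by (simp add: T.span_zero)
    next
      case (Cons p xs)
      have "tens (fst p) (snd p) \<in> T.span {tens h w |h w. h \<in> L}"
        using Cons.prems by (intro T.span_base) auto
      then show ?case using Cons by (auto intro: T.span_add)
    qed
  qed
qed

section \<open>The operator \<open>F \<otimes> 1\<close>\<close>

text \<open>\<open>R\<close> pairs the tensor represented by a list with its intended image.
  Comparing \<open>F\<close> with the identity in \<open>norm_tens_sum_le\<close> bounds this
  relation, and its domain is dense, so it extends to an operator.\<close>

lemma ex_tensor_one:
  assumes F: "bounded_operator scaleH scaleH F"
  obtains G where "bounded_operator scaleT scaleT G" "\<And>h w. G (tens h w) = tens (F h) w"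
proof -
  have lF: "Vector_Spaces.linear scaleH scaleH F" using F by (simp add: bounded_operator_def)
  obtain C where C: "C \<ge> 0" "\<And>x. norm (F x) \<le> C * norm x"
    using bounded_linear.nonneg_bounded[of F] F unfolding bounded_operator_def
    by (metis mult.commute)
  define R where "R = range (\<lambda>xs. (tens_sum (\<lambda>x. x) xs, tens_sum F xs))"
  have add: "(a + c, b + d) \<in> R" if "(a, b) \<in> R" "(c, d) \<in> R" for a b c d
    using that unfolding R_def by (auto simp: tens_sum_append[symmetric])
  have scl: "(scaleT k a, scaleT k b) \<in> R" if "(a, b) \<in> R" for a b k
    using that unfolding R_def
    by (auto simp: tens_sum_scale[OF lF, symmetric] tens_sum_scale[OF linear_id, symmetric])
  have bnd: "norm b \<le> C * norm a" if "(a, b) \<in> R" for a b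
    using that norm_tens_sum_le[OF H.subspace_UNIV _ lF linear_id C(1)] C(2)
    unfolding R_def by auto
  have "fst ` R = T.span {tens h w |h w. h \<in> UNIV}"
    unfolding span_tens_eq[OF H.subspace_UNIV] R_def by (auto simp: image_image)
  then have dense: "closure (fst ` R) = UNIV" using dense_tens by simp
  obtain G where G: "bounded_operator scaleT scaleT G" "\<And>a b. (a, b) \<in> R \<Longrightarrow> G a = b"
    using T.bounded_operator_of_graph[OF add scl bnd dense] by blast
  have "(tens h w, tens (F h) w) \<in> R" for h w
    unfolding R_def by (rule range_eqI[of _ _ "[(h, w)]"]) (simp add: tens_sum_def)
  then show ?thesis using that G by blast
qed

lemma bounded_operator_eqI:
  assumes F: "bounded_operator scaleT scaleT F" and G: "bounded_operator scaleT scaleT G"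
    and eq: "\<And>x. x \<in> X \<Longrightarrow> F x = G x" and t: "t \<in> closure (T.span X)"
  shows "F t = G t"
proof -
  have "T.span X \<subseteq> {x. F x = G x}"
  proof
    fix x assume "x \<in> T.span X"
    then show "x \<in> {x. F x = G x}"
      by (induction rule: T.span_induct_alt)
        (use eq in \<open>auto simp: T.bounded_operatorD[OF F] T.bounded_operatorD[OF G]\<close>)
  qed
  moreover have "closed {x. F x = G x}"
    by (intro closed_Collect_eq linear_continuous_on T.bounded_operatorD(1) F G)
  ultimately show ?thesis using closure_minimal[of "T.span X" "{x. F x = G x}"] t by blast
qed

text \<open>Existence together with uniqueness by density resolves the definite description in the
  definition.\<close>

lemma tensor_one:
  assumes F: "bounded_operator scaleH scaleH F"
  shows "bounded_operator scaleT scaleT (tensor_one scaleT tens F)"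
    and "tensor_one scaleT tens F (tens h w) = tens (F h) w"
proof -
  let ?P = "\<lambda>G. bounded_operator scaleT scaleT G \<and> (\<forall>h w. G (tens h w) = tens (F h) w)"
  obtain G where G: "?P G" using ex_tensor_one[OF F] by blast
  have "G' = G" if "?P G'" for G'
  proof
    fix t
    show "G' t = G t"
      by (rule bounded_operator_eqI[where X = "{tens h w |h w. True}"])
        (use that G dense_tens in auto)
  qed
  then have "?P (tensor_one scaleT tens F)"
    unfolding tensor_one_def by (intro theI[of ?P G] G)
  then show "bounded_operator scaleT scaleT (tensor_one scaleT tens F)"
    "tensor_one scaleT tens F (tens h w) = tens (F h) w" by blast+
qed

lemma tensor_one_tens_sum:
  assumes F: "bounded_operator scaleH scaleH F"
  shows "tensor_one scaleT tens F (tens_sum (\<lambda>x. x) xs) = tens_sum F xs"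
  by (induction xs) (auto simp: tens_sum_def T.bounded_operatorD[OF tensor_one(1)[OF F]] tensor_one(2)[OF F])

text \<open>On algebraic tensors with first factors in \<open>L\<close> this is
  \<open>norm_tens_sum_le\<close>; both sides are continuous, so it passes to the closure.\<close>

lemma norm_tensor_one_le:
  assumes L: "H.subspace L"
    and A: "bounded_operator scaleH scaleH A" and B: "bounded_operator scaleH scaleH B"
    and C: "C \<ge> 0" "\<And>x. x \<in> L \<Longrightarrow> norm (A x) \<le> C * norm (B x)"
    and t: "t \<in> tensor_subspace scaleT tens L"
  shows "norm (tensor_one scaleT tens A t) \<le> C * norm (tensor_one scaleT tens B t)"
proof -
  let ?S = "{t. norm (tensor_one scaleT tens A t) \<le> C * norm (tensor_one scaleT tens B t)}"
  have "T.span {tens h w |h w. h \<in> L} \<subseteq> ?S"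
    unfolding span_tens_eq[OF L]
    using norm_tens_sum_le[OF L _ _ _ C] A B
    by (auto simp: tensor_one_tens_sum bounded_operator_def)
  moreover have "closed ?S"
    by (intro closed_Collect_le continuous_intros linear_continuous_on
        T.bounded_operatorD(1) tensor_one(1) A B)
  ultimately show ?thesis
    using t closure_minimal[of "T.span {tens h w |h w. h \<in> L}" ?S] unfolding tensor_subspace_def by blast
qed

text \<open>Both sides are bounded operators in \<open>t\<close> that agree on elementary
  tensors.\<close>

lemma tensor_one_absorb:
  assumes A: "bounded_operator scaleH scaleH A" and B: "bounded_operator scaleH scaleH B"
    and AB: "\<And>x. A (B x) = A x"
  shows "tensor_one scaleT tens A (tensor_one scaleT tens B t) = tensor_one scaleT tens A t"
proof (rule bounded_operator_eqI[where X = "{tens h w |h w. True}"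
      and F = "\<lambda>t. tensor_one scaleT tens A (tensor_one scaleT tens B t)"])
  show "bounded_operator scaleT scaleT (\<lambda>t. tensor_one scaleT tens A (tensor_one scaleT tens B t))"
    using tensor_one(1)[OF A] tensor_one(1)[OF B]
    by (auto simp: bounded_operator_def Vector_Spaces.linear_iff intro: bounded_linear_compose)
qed (use A B AB dense_tens in \<open>auto simp: tensor_one\<close>)

lemma tensor_one_tensor_subspace:
  assumes A: "bounded_operator scaleH scaleH A" and AL: "\<And>x. x \<in> L \<Longrightarrow> A x \<in> L"
    and t: "t \<in> tensor_subspace scaleT tens L"
  shows "tensor_one scaleT tens A t \<in> tensor_subspace scaleT tens L"
proof -
  let ?X = "{tens h w |h w. h \<in> L}" and ?G = "tensor_one scaleT tens A"
  note G = T.bounded_operatorD[OF tensor_one(1)[OF A]]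
  have "?G ` T.span ?X \<subseteq> T.span ?X"
  proof clarify
    fix t assume "t \<in> T.span ?X"
    then show "?G t \<in> T.span ?X"
    proof (induction rule: T.span_induct_alt)
      case base
      show ?case by (simp add: G T.span_zero)
    next
      case (step c x y)
      then obtain h w where "x = tens h w" "h \<in> L" by blast
      then have "?G x \<in> T.span ?X" using AL by (auto simp: tensor_one(2)[OF A] intro!: T.span_base)
      then show ?case unfolding G using step by (intro T.span_add T.span_scale)
    qed
  qed
  then have "?G ` closure (T.span ?X) \<subseteq> closure (T.span ?X)"
    using closure_subset by (intro image_closure_subset linear_continuous_on G(1)) auto
  then show ?thesis using t unfolding tensor_subspace_def by blast
qed

lemma diff_in_tensor_subspace:
  assumes "s \<in> tensor_subspace scaleT tens L" "t \<in> tensor_subspace scaleT tens L"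
  shows "s - t \<in> tensor_subspace scaleT tens L"
proof -
  let ?X = "T.span {tens h w |h w. h \<in> L}"
  obtain u v where u: "\<And>n. u n \<in> ?X" "u \<longlonglongrightarrow> s" and v: "\<And>n. v n \<in> ?X" "v \<longlonglongrightarrow> t"
    using assms unfolding tensor_subspace_def closure_sequential by blast
  have "u n - v n \<in> ?X" for n using u(1) v(1) by (rule T.span_diff)
  moreover have "(\<lambda>n. u n - v n) \<longlonglongrightarrow> s - t" using u(2) v(2) by (rule tendsto_diff)
  ultimately show ?thesis
    unfolding tensor_subspace_def closure_sequential by (intro exI[of _ "\<lambda>n. u n - v n"] conjI allI)
qed

section \<open>Closedness of the image\<close>

text \<open>The preimages \<open>t n\<close> of a convergent sequence may drift along the kernel of
  \<open>F \<otimes> 1\<close>. Applying \<open>Q \<otimes> 1\<close> keeps their images and their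
  membership in \<open>L \<otimes> W\<close>, and makes them a Cauchy sequence.\<close>

lemma closed_tensor_one_image:
  assumes L: "H.subspace L"
    and F: "bounded_operator scaleH scaleH F" and Q: "bounded_operator scaleH scaleH Q"
    and C: "C \<ge> 0" "\<And>x. x \<in> L \<Longrightarrow> norm (Q x) \<le> C * norm (F x)"
    and QL: "\<And>x. x \<in> L \<Longrightarrow> Q x \<in> L" and FQ: "\<And>x. F (Q x) = F x"
  shows "closed (tensor_one scaleT tens F ` tensor_subspace scaleT tens L)"
  unfolding closed_sequential_limits
proof (intro allI impI, elim conjE)
  let ?F = "tensor_one scaleT tens F" and ?Q = "tensor_one scaleT tens Q"
  let ?S = "tensor_subspace scaleT tens L"
  note F' = T.bounded_operatorD[OF tensor_one(1)[OF F]]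
  note Q' = T.bounded_operatorD[OF tensor_one(1)[OF Q]]
  fix y z assume "\<forall>n. y n \<in> ?F ` ?S" and lim: "y \<longlonglongrightarrow> z"
  then have "\<forall>n. \<exists>t\<in>?S. y n = ?F t" by (simp add: image_iff)
  then obtain t where t: "\<And>n. t n \<in> ?S" "\<And>n. ?F (t n) = y n" by metis
  \<comment> \<open>\<open>C\<close> may be 0; \<open>C + 1\<close> can safely serve as a divisor
    below.\<close>
  have bound: "norm (?Q (t m) - ?Q (t n)) \<le> (C + 1) * norm (y m - y n)" for m n
  proof -
    have "norm (?Q (t m - t n)) \<le> C * norm (?F (t m - t n))"
      by (intro norm_tensor_one_le[OF L Q F C] diff_in_tensor_subspace t)
    then show ?thesis using mult_right_mono[of C "C + 1" "norm (y m - y n)"]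
      by (simp add: F' Q' t(2))
  qed
  have "Cauchy (\<lambda>n. ?Q (t n))"
  proof (rule metric_CauchyI)
    fix e :: real assume "e > 0"
    then have "e / (C + 1) > 0" using C by simp
    then obtain M where M: "\<And>m n. m \<ge> M \<Longrightarrow> n \<ge> M \<Longrightarrow> dist (y m) (y n) < e / (C + 1)"
      using LIMSEQ_imp_Cauchy[OF lim] unfolding Cauchy_def by blast
    have "dist (?Q (t m)) (?Q (t n)) < e" if "m \<ge> M" "n \<ge> M" for m n
    proof -
      have "(C + 1) * norm (y m - y n) < e"
        using M[OF that] C(1) by (simp add: dist_norm pos_less_divide_eq mult.commute)
      then show ?thesis using bound[of m n] by (simp add: dist_norm)
    qed
    then show "\<exists>M. \<forall>m\<ge>M. \<forall>n\<ge>M. dist (?Q (t m)) (?Q (t n)) < e" by blast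
  qed
  then obtain s where s: "(\<lambda>n. ?Q (t n)) \<longlonglongrightarrow> s" using Cauchy_convergent convergent_def by blast
  have "s \<in> ?S"
  proof (rule closed_sequentially[OF _ _ s])
    show "closed ?S" by (simp add: tensor_subspace_def)
    show "?Q (t n) \<in> ?S" for n by (rule tensor_one_tensor_subspace[OF Q QL t(1)])
  qed
  moreover have "?F s = z"
  proof -
    have "(\<lambda>n. ?F (?Q (t n))) \<longlonglongrightarrow> ?F s" by (rule bounded_linear.tendsto[OF F'(1) s])
    then have "y \<longlonglongrightarrow> ?F s" by (simp add: tensor_one_absorb[OF F Q FQ] t(2))
    then show ?thesis using lim LIMSEQ_unique by blast
  qed
  ultimately show "z \<in> ?F ` ?S" by blast
qed

end

theorem lemma0p1:
  fixes scaleH :: "'k::real_or_complex \<Rightarrow> 'h::banach \<Rightarrow> 'h" and ipH :: "'h \<Rightarrow> 'h \<Rightarrow> 'k"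
    and scaleW :: "'k \<Rightarrow> 'w::banach \<Rightarrow> 'w" and ipW :: "'w \<Rightarrow> 'w \<Rightarrow> 'k"
    and scaleT :: "'k \<Rightarrow> 't::banach \<Rightarrow> 't" and ipT :: "'t \<Rightarrow> 't \<Rightarrow> 'k"
    and tens :: "'h \<Rightarrow> 'w \<Rightarrow> 't"
    and F :: "'h \<Rightarrow> 'h" and L :: "'h set"
  assumes "hilbert_space scaleH ipH"
    and "bounded_operator scaleH scaleH F"
    and "closed (range F)"
    and "\<exists>B. finite B \<and> {x. F x = 0} = module.span scaleH B"
    and "module.subspace scaleH L" and "closed L"
    and "hilbert_space scaleW ipW"
    and "hilbert_tensor_product scaleH ipH scaleW ipW scaleT ipT tens"
  shows "closed (tensor_one scaleT tens F ` tensor_subspace scaleT tens L)"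
proof -
  interpret hilbert_tensor_product scaleH ipH scaleW ipW scaleT ipT tens by fact
  obtain B where B: "finite B" "{x. F x = 0} = H.span B" using assms(4) by blast
  obtain Q C where "bounded_operator scaleH scaleH Q" "C \<ge> 0" "\<And>x. x \<in> L \<Longrightarrow> Q x \<in> L"
    "\<And>x. F (Q x) = F x" "\<And>x. x \<in> L \<Longrightarrow> norm (Q x) \<le> C * norm (F x)"
    using H.ex_operator_bounded_by[OF assms(2,3) B assms(5,6)] by blast
  then show ?thesis
    using closed_tensor_one_image[OF assms(5,2)] by blast
qed

end
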